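(* Let $\sum_{k=1}^\infty c_k$ be a convergent series of numbers with $c_k\neq0$ for all $k\ge1$. Define $b_1=2$, $a_1=2c_1$, and $$b_n=\frac{2(c_n+c_{n-1})}{c_{n-1}}\quad\text{and}\quad a_n=\frac{-4c_n}{c_{n-1}}\qquad\text{for } n\ge2.$$ Then $$\sum_{k=1}^\infty c_k=\cfrac{a_1}{b_1+\cfrac{a_2}{b_2+\cfrac{a_3}{b_3+\cfrac{a_4}{b_4+\ddots}}}}.$$
   Context: For sequences of (real or complex) numbers $(a_n)_{n\ge1}$ and $(b_n)_{n\ge0}$, the $n$-th convergent $A_n/B_n$ of the (generalized) continued fraction $b_0+\cfrac{a_1}{b_1+\cfrac{a_2}{b_2+\ddots}}$ is its truncation at $a_n/b_n$. The sequences $(A_n)$, $(B_n)$ satisfy $A_n=b_nA_{n-1}+a_nA_{n-2}$ and $B_n=b_nB_{n-1}+a_nB_{n-2}$ for $n\ge1$, with $A_{-1}=1$, $A_0=b_0$, $B_{-1}=0$, $B_0=1$. A number $x$ equals the continued fraction if $\lim_{n\to\infty}A_n/B_n=x$. When no term $b_0$ is written, $b_0=0$. *)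

theory Defs
  imports Complex_Main
begin

text \<open>
  Continued fractions \<open>b 0 + a 1 / (b 1 + a 2 / (b 2 + \<dots>))\<close>; the value \<open>a 0\<close> is never used.
  The recurrence starts from \<open>A\<^sub>-\<^sub>1 = 1\<close>, \<open>A\<^sub>0 = b 0\<close>, \<open>B\<^sub>-\<^sub>1 = 0\<close>, \<open>B\<^sub>0 = 1\<close>; the index \<open>-1\<close> is
  eliminated by writing its values into the equations for \<open>n = 1\<close>.
\<close>

fun cf_num :: "(nat \<Rightarrow> 'a::field) \<Rightarrow> (nat \<Rightarrow> 'a) \<Rightarrow> nat \<Rightarrow> 'a" where
  "cf_num b a 0 = b 0"
| "cf_num b a (Suc 0) = b 1 * b 0 + a 1 * 1"
| "cf_num b a (Suc (Suc n)) =
     b (Suc (Suc n)) * cf_num b a (Suc n) + a (Suc (Suc n)) * cf_num b a n"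

fun cf_den :: "(nat \<Rightarrow> 'a::field) \<Rightarrow> (nat \<Rightarrow> 'a) \<Rightarrow> nat \<Rightarrow> 'a" where
  "cf_den b a 0 = 1"
| "cf_den b a (Suc 0) = b 1 * 1 + a 1 * 0"
| "cf_den b a (Suc (Suc n)) =
     b (Suc (Suc n)) * cf_den b a (Suc n) + a (Suc (Suc n)) * cf_den b a n"

text \<open>
  Since \<open>x / 0 = 0\<close>, convergents with a vanishing denominator must be excluded explicitly: all
  but finitely many of them are required to be defined.
\<close>

definition cf_equals ::
  "(nat \<Rightarrow> 'a::real_normed_field) \<Rightarrow> (nat \<Rightarrow> 'a) \<Rightarrow> 'a \<Rightarrow> bool" where
  "cf_equals b a x \<longleftrightarrow>
     (\<forall>\<^sub>F n in sequentially. cf_den b a n \<noteq> 0) \<and>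
     (\<lambda>n. cf_num b a n / cf_den b a n) \<longlonglongrightarrow> x"

text \<open>
  The truncation at \<open>a n / b n\<close>, as a nested fraction, is the case \<open>m = 0\<close>, \<open>k = n\<close> of the following
  function. It agrees with the quotient above whenever no division by zero occurs inside it.
  Truncations are not used in \<open>cf_equals\<close> because an inner denominator may vanish although the
  convergent exists: if \<open>b 2 = 0\<close> and \<open>a 2 \<noteq> 0\<close>, then the convergent at \<open>n = 2\<close> is \<open>b 0\<close>.
\<close>

fun cf_trunc :: "(nat \<Rightarrow> 'a::field) \<Rightarrow> (nat \<Rightarrow> 'a) \<Rightarrow> nat \<Rightarrow> nat \<Rightarrow> 'a" where
  "cf_trunc b a m 0 = b m"
| "cf_trunc b a m (Suc k) = b m + a (Suc m) / cf_trunc b a (Suc m) k"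

lemma cf_num_shift:
  "cf_num b a (Suc n) =
     b 0 * cf_num (b \<circ> Suc) (a \<circ> Suc) n + a 1 * cf_den (b \<circ> Suc) (a \<circ> Suc) n"
  by (induction n rule: induct_nat_012) (simp_all add: algebra_simps)

lemma cf_den_shift: "cf_den b a (Suc n) = cf_num (b \<circ> Suc) (a \<circ> Suc) n"
  by (induction n rule: induct_nat_012) (simp_all add: algebra_simps)

lemma cf_trunc_shift: "cf_trunc (b \<circ> Suc) (a \<circ> Suc) m k = cf_trunc b a (Suc m) k"
  by (induction k arbitrary: m) simp_all

lemma cf_trunc_eq_convergent:
  assumes "\<And>m. 1 \<le> m \<Longrightarrow> m \<le> n \<Longrightarrow> cf_trunc b a m (n - m) \<noteq> 0"
  shows "cf_den b a n \<noteq> 0 \<and> cf_trunc b a 0 n = cf_num b a n / cf_den b a n"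
  using assms
proof (induction n arbitrary: a b)
  case 0
  then show ?case by simp
next
  case (Suc n)
  let ?b = "b \<circ> Suc" and ?a = "a \<circ> Suc"
  have IH: "cf_den ?b ?a n \<noteq> 0" "cf_trunc b a 1 n = cf_num ?b ?a n / cf_den ?b ?a n"
  proof -
    have "cf_trunc ?b ?a m (n - m) \<noteq> 0" if "1 \<le> m" "m \<le> n" for m
      using Suc.prems[of "Suc m"] that unfolding cf_trunc_shift by simp
    from Suc.IH[of ?b ?a, OF this] show "cf_den ?b ?a n \<noteq> 0"
      "cf_trunc b a 1 n = cf_num ?b ?a n / cf_den ?b ?a n"
      unfolding cf_trunc_shift One_nat_def by blast+
  qed
  moreover have "cf_trunc b a 1 n \<noteq> 0"
    using Suc.prems[of 1] by simp
  ultimately have nz: "cf_num ?b ?a n \<noteq> 0"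
    by auto
  have "cf_trunc b a 0 (Suc n) = b 0 + a 1 / (cf_num ?b ?a n / cf_den ?b ?a n)"
    using IH(2) by simp
  with nz IH(1) show ?case
    by (simp add: cf_num_shift cf_den_shift add_divide_distrib del: cf_trunc.simps)
qed

end

theory Submission
  imports Defs
begin

text \<open>
  With \<open>r = c n / c (n - 1)\<close> the coefficients are \<open>b n = 2 (1 + r)\<close> and \<open>a n = - 4 r\<close>, so the
  substitution \<open>X n = 2 ^ n * Y n\<close> turns the recurrence
  \<open>X n = b n * X (n - 1) + a n * X (n - 2)\<close> into
  \<open>Y n - Y (n - 1) = r * (Y (n - 1) - Y (n - 2))\<close>. Its solutions are the sequences whose
  increments are proportional to \<open>c n\<close>. By the initial values, the denominators correspond to the
  constant sequence \<open>1\<close> and the numerators to the partial sums of the series. Thus the convergents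
  of the continued fraction are exactly the partial sums, and no denominator vanishes.
\<close>

lemma cf_den_eq_power_two:
  fixes a b c :: "nat \<Rightarrow> 'a::field"
  assumes "\<And>n. c (Suc n) \<noteq> 0"
    and "b 1 = 2"
    and "\<And>n. b (Suc (Suc n)) = 2 * (c (Suc (Suc n)) + c (Suc n)) / c (Suc n)"
    and "\<And>n. a (Suc (Suc n)) = - 4 * c (Suc (Suc n)) / c (Suc n)"
  shows "cf_den b a n = 2 ^ n"
  by (induction n rule: induct_nat_012) (simp_all add: assms[unfolded One_nat_def] field_simps)

lemma cf_num_eq_power_two_times_partial_sum:
  fixes a b c :: "nat \<Rightarrow> 'a::field"
  assumes "\<And>n. c (Suc n) \<noteq> 0"
    and "b 0 = 0" and "a 1 = 2 * c 1"
    and "\<And>n. b (Suc (Suc n)) = 2 * (c (Suc (Suc n)) + c (Suc n)) / c (Suc n)"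
    and "\<And>n. a (Suc (Suc n)) = - 4 * c (Suc (Suc n)) / c (Suc n)"
  shows "cf_num b a n = 2 ^ n * (\<Sum>k<n. c (Suc k))"
  by (induction n rule: induct_nat_012) (simp_all add: assms[unfolded One_nat_def] field_simps)

theorem theorem4:
  fixes a b c :: "nat \<Rightarrow> 'a::real_normed_field"
  assumes "summable (\<lambda>k. c (Suc k))"
    and "\<forall>k\<ge>1. c k \<noteq> 0"
    and "b 0 = 0"
    and "b 1 = 2" and "a 1 = 2 * c 1"
    and "\<forall>n\<ge>2. b n = 2 * (c n + c (n - 1)) / c (n - 1)"
    and "\<forall>n\<ge>2. a n = - 4 * c n / c (n - 1)"
  shows "cf_equals b a (\<Sum>k. c (Suc k))"
proof -
  have c: "c (Suc n) \<noteq> 0"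
    and b: "b (Suc (Suc n)) = 2 * (c (Suc (Suc n)) + c (Suc n)) / c (Suc n)"
    and a: "a (Suc (Suc n)) = - 4 * c (Suc (Suc n)) / c (Suc n)" for n
    using assms(2,6,7) by simp_all
  have den: "cf_den b a n = 2 ^ n" for n
    using c assms(4) b a by (rule cf_den_eq_power_two)
  have num: "cf_num b a n = 2 ^ n * (\<Sum>k<n. c (Suc k))" for n
    using c assms(3,5) b a by (rule cf_num_eq_power_two_times_partial_sum)
  have "(\<lambda>n. cf_num b a n / cf_den b a n) = (\<lambda>n. \<Sum>k<n. c (Suc k))"
    by (simp add: num den)
  with summable_LIMSEQ[OF assms(1)] show ?thesis
    by (simp add: cf_equals_def den)
qed

end
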